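(* For all real numbers $x,y \ge 0$ and $\theta \in [0,\pi]$, $$(\sin\theta)^3 xy + \left((\cos\theta)^3 -3\cos\theta +2\right) (x+y) - (\sin\theta)^3-6\sin\theta -6\theta + 6\pi - 6\arctan(x) +\frac{2x}{1+x^2} -6\arctan(y) +\frac{2y}{1+y^2} \ge 0,$$ with equality at $x=y=\cot(\theta/2)$.
   Context: Here $\arctan$ is the principal branch with values in $(-\pi/2,\pi/2)$. For $\theta=0$ the convention is $\cot(0)=\infty$, so the equality assertion concerns actual real points $x=y=\cot(\theta/2)$ only for $\theta\in(0,\pi]$; at $\theta=\pi$ one has $\cot(\pi/2)=0$. *)

theory Defs
  imports Complex_Main
begin

definition arctan_expr :: "real \<Rightarrow> real \<Rightarrow> real \<Rightarrow> real" where
  "arctan_expr \<theta> x y =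
     (sin \<theta>) ^ 3 * x * y + ((cos \<theta>) ^ 3 - 3 * cos \<theta> + 2) * (x + y)
     - (sin \<theta>) ^ 3 - 6 * sin \<theta> - 6 * \<theta> + 6 * pi
     - 6 * arctan x + 2 * x / (1 + x ^ 2)
     - 6 * arctan y + 2 * y / (1 + y ^ 2)"

text \<open>
  In HOL \<^term>\<open>cot (0::real)\<close> is the real number 0, whereas the intended convention is
  $\cot 0 = \infty$. An equality at $x = y = \cot(\theta/2)$ therefore only concerns real points
  when $\theta > 0$.
\<close>

end

theory Submission
  imports Defs
begin

text \<open>
  Put \<open>z = cot (\<theta> / 2)\<close>; the expression becomes a function \<open>F x y z\<close>, symmetric in \<open>x\<close> and \<open>y\<close>,
  convex in each of them, and vanishing with its gradient on the diagonal \<open>x = y = z\<close>. If \<open>z\<close> does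
  not lie strictly between \<open>y\<close> and \<open>x\<close>, then convexity lets us move first \<open>x\<close> and then \<open>y\<close> to \<open>z\<close>
  without increasing \<open>F\<close>. Otherwise fix \<open>0 < y < x\<close> and minimise over \<open>z \<in> [y, x]\<close>. At an interior
  minimum the numerator of \<open>\<partial>F/\<partial>z\<close> vanishes; as it is affine in \<open>x\<close>, this says that \<open>x = X z\<close> for an
  explicit rational function \<open>X\<close> with \<open>X y = y\<close>. Along the curve \<open>t \<mapsto> (X t, y, t)\<close>, \<open>t \<ge> y\<close>,
  the derivative of \<open>F\<close> is \<open>(\<partial>F/\<partial>x) X'\<close>, and both factors are nonnegative, so
  \<open>F (X z) y z \<ge> F y y y = 0\<close>.
\<close>

text \<open>At z = cot(\<theta>/2) one has sin \<theta> = 2z/(1+z^2) and cos \<theta> =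
  (z^2-1)/(1+z^2). Hence \<open>A\<close> is the coefficient (sin \<theta>)^3 of xy,
  \<open>B\<close> the coefficient of x + y, and \<open>K\<close> the part free of x and y.\<close>

definition A :: "real \<Rightarrow> real" where
  "A z = 8 * z ^ 3 / (1 + z\<^sup>2) ^ 3"

definition B :: "real \<Rightarrow> real" where
  "B z = 4 * (3 * z\<^sup>2 + 1) / (1 + z\<^sup>2) ^ 3"

definition K :: "real \<Rightarrow> real" where
  "K z = 12 * arctan z - 12 * z / (1 + z\<^sup>2) - A z"

definition g :: "real \<Rightarrow> real" where
  "g x = 2 * x / (1 + x\<^sup>2) - 6 * arctan x"

text \<open>This is minus the derivative of \<open>g\<close>, in a form that shows it to decrease on
  x \<ge> 0.\<close>

definition G :: "real \<Rightarrow> real" where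
  "G x = 4 - 4 * (x\<^sup>2 / (1 + x\<^sup>2))\<^sup>2"

definition F :: "real \<Rightarrow> real \<Rightarrow> real \<Rightarrow> real" where
  "F x y z = A z * x * y + B z * (x + y) + K z + g x + g y"

text \<open>The partial derivative of \<open>F\<close> in z without its factor
  24z^2/(1+z^2)^4.\<close>

definition P :: "real \<Rightarrow> real \<Rightarrow> real \<Rightarrow> real" where
  "P x y z = z ^ 4 + 3 * z\<^sup>2 + x * y * (1 - z\<^sup>2) - 2 * z * (x + y)"

definition X :: "real \<Rightarrow> real \<Rightarrow> real" where
  "X y z = z * (z ^ 3 + 3 * z - 2 * y) / (2 * z - y + y * z\<^sup>2)"

section \<open>Derivatives\<close>

lemma one_plus_square_pos [simp]: "0 < 1 + (z::real)\<^sup>2"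
  by (simp add: add_pos_nonneg)

lemma one_plus_square_neq_0 [simp]: "1 + (z::real)\<^sup>2 \<noteq> 0"
  using one_plus_square_pos[of z] by linarith

lemma DERIV_A: "(A has_real_derivative 24 * z\<^sup>2 * (1 - z\<^sup>2) / (1 + z\<^sup>2) ^ 4) (at z)"
proof -
  have "(A has_real_derivative
      (24 * z\<^sup>2 * (1 + z\<^sup>2) ^ 3 - 8 * z ^ 3 * (3 * (1 + z\<^sup>2)\<^sup>2 * (2 * z))) /
      ((1 + z\<^sup>2) ^ 3 * (1 + z\<^sup>2) ^ 3)) (at z)"
    unfolding A_def[abs_def]
    by (rule derivative_eq_intros refl | simp)+
  also have "(24 * z\<^sup>2 * (1 + z\<^sup>2) ^ 3 - 8 * z ^ 3 * (3 * (1 + z\<^sup>2)\<^sup>2 * (2 * z))) /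
      ((1 + z\<^sup>2) ^ 3 * (1 + z\<^sup>2) ^ 3) = 24 * z\<^sup>2 * (1 - z\<^sup>2) / (1 + z\<^sup>2) ^ 4"
    by (simp add: frac_eq_eq) algebra
  finally show ?thesis .
qed

lemma DERIV_B: "(B has_real_derivative - 48 * z ^ 3 / (1 + z\<^sup>2) ^ 4) (at z)"
proof -
  have "(B has_real_derivative
      (24 * z * (1 + z\<^sup>2) ^ 3 - 4 * (3 * z\<^sup>2 + 1) * (3 * (1 + z\<^sup>2)\<^sup>2 * (2 * z))) /
      ((1 + z\<^sup>2) ^ 3 * (1 + z\<^sup>2) ^ 3)) (at z)"
    unfolding B_def[abs_def]
    by (rule derivative_eq_intros refl | simp)+
  also have "(24 * z * (1 + z\<^sup>2) ^ 3 - 4 * (3 * z\<^sup>2 + 1) * (3 * (1 + z\<^sup>2)\<^sup>2 * (2 * z))) /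
      ((1 + z\<^sup>2) ^ 3 * (1 + z\<^sup>2) ^ 3) = - 48 * z ^ 3 / (1 + z\<^sup>2) ^ 4"
    by (simp add: frac_eq_eq del: minus_divide_left divide_minus_left) algebra
  finally show ?thesis .
qed

lemma DERIV_x_over_one_plus_square:
  "((\<lambda>x::real. x / (1 + x\<^sup>2)) has_real_derivative (1 - x\<^sup>2) / (1 + x\<^sup>2)\<^sup>2) (at x)"
proof -
  have "((\<lambda>x::real. x / (1 + x\<^sup>2)) has_real_derivative
      (1 * (1 + x\<^sup>2) - x * (2 * x)) / ((1 + x\<^sup>2) * (1 + x\<^sup>2))) (at x)"
    by (rule derivative_eq_intros refl | simp)+
  then show ?thesis by (simp add: power2_eq_square)
qed

lemma DERIV_K:
  "(K has_real_derivative 24 * z\<^sup>2 / (1 + z\<^sup>2)\<^sup>2 - 24 * z\<^sup>2 * (1 - z\<^sup>2) / (1 + z\<^sup>2) ^ 4) (at z)"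
proof -
  have "((\<lambda>z. 12 * arctan z - 12 * (z / (1 + z\<^sup>2)) - A z) has_real_derivative
      12 * inverse (1 + z\<^sup>2) - 12 * ((1 - z\<^sup>2) / (1 + z\<^sup>2)\<^sup>2)
      - 24 * z\<^sup>2 * (1 - z\<^sup>2) / (1 + z\<^sup>2) ^ 4) (at z)"
    by (intro DERIV_diff DERIV_cmult DERIV_A DERIV_arctan DERIV_x_over_one_plus_square)
  moreover have "12 * inverse (1 + z\<^sup>2) - 12 * ((1 - z\<^sup>2) / (1 + z\<^sup>2)\<^sup>2) = 24 * z\<^sup>2 / (1 + z\<^sup>2)\<^sup>2"
    by (simp add: divide_simps) algebra
  ultimately show ?thesis by (simp add: K_def[abs_def])
qed

lemma DERIV_g: "(g has_real_derivative - G x) (at x)"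
proof -
  have "((\<lambda>x. 2 * (x / (1 + x\<^sup>2)) - 6 * arctan x) has_real_derivative
      2 * ((1 - x\<^sup>2) / (1 + x\<^sup>2)\<^sup>2) - 6 * inverse (1 + x\<^sup>2)) (at x)"
    by (intro DERIV_diff DERIV_cmult DERIV_arctan DERIV_x_over_one_plus_square)
  moreover have "2 * ((1 - x\<^sup>2) / (1 + x\<^sup>2)\<^sup>2) - 6 * inverse (1 + x\<^sup>2) = - G x"
    unfolding G_def by (simp add: divide_simps) algebra
  ultimately show ?thesis by (simp add: g_def[abs_def])
qed

text \<open>Total derivative along t \<mapsto> (f t, y, t). Constant f gives the partial derivative
  in z, and f = \<open>X y\<close> the derivative along the critical curve.\<close>

lemma DERIV_F_curve:
  assumes "(f has_real_derivative f') (at z)"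
  shows "((\<lambda>t. F (f t) y t) has_real_derivative
    (A z * y + B z - G (f z)) * f' + 24 * z\<^sup>2 * P (f z) y z / (1 + z\<^sup>2) ^ 4) (at z)"
proof -
  have deriv: "((\<lambda>t. F (f t) y t) has_real_derivative
      ((24 * z\<^sup>2 * (1 - z\<^sup>2) / (1 + z\<^sup>2) ^ 4) * f z + f' * A z) * y
      + ((- 48 * z ^ 3 / (1 + z\<^sup>2) ^ 4) * (f z + y) + (f' + 0) * B z)
      + (24 * z\<^sup>2 / (1 + z\<^sup>2)\<^sup>2 - 24 * z\<^sup>2 * (1 - z\<^sup>2) / (1 + z\<^sup>2) ^ 4)
      + (- G (f z)) * f' + 0) (at z)"
    unfolding F_def
    by (intro DERIV_add DERIV_mult DERIV_cmult_right DERIV_A DERIV_B DERIV_K DERIV_const assms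
        DERIV_chain2[OF DERIV_g])
  have e: "24 * z\<^sup>2 / (1 + z\<^sup>2)\<^sup>2 = 24 * z\<^sup>2 * (1 + z\<^sup>2)\<^sup>2 / (1 + z\<^sup>2) ^ 4"
    by (simp add: frac_eq_eq)
  show ?thesis
    by (rule DERIV_cong[OF deriv], unfold e P_def divide_inverse[of _ "(1 + z\<^sup>2) ^ 4"])
      (simp add: algebra_simps power2_eq_square power3_eq_cube power4_eq_xxxx)
qed

section \<open>Symmetry, the diagonal, and convexity\<close>

lemma F_commute: "F x y z = F y x z"
  by (simp add: F_def algebra_simps)

lemma F_diagonal: "F z z z = 0"
proof -
  have "8 * z ^ 3 / (1 + z\<^sup>2) ^ 3 * z * z + 4 * (3 * z\<^sup>2 + 1) / (1 + z\<^sup>2) ^ 3 * (z + z)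
      - 12 * z / (1 + z\<^sup>2) - 8 * z ^ 3 / (1 + z\<^sup>2) ^ 3 + 4 * z / (1 + z\<^sup>2) = 0"
    by (simp add: divide_simps) algebra
  then show ?thesis by (simp add: F_def A_def B_def K_def g_def)
qed

text \<open>The partial derivative of \<open>F\<close> in x vanishes on the diagonal.\<close>

lemma G_diagonal: "A z * z + B z = G z"
  unfolding A_def B_def G_def by (simp add: divide_simps) algebra

lemma G_antimono:
  assumes "0 \<le> x" "x \<le> y"
  shows "G y \<le> G x"
proof -
  have "x\<^sup>2 \<le> y\<^sup>2" using assms by (simp add: power_mono)
  then have "x\<^sup>2 / (1 + x\<^sup>2) \<le> y\<^sup>2 / (1 + y\<^sup>2)"
    by (simp add: divide_simps algebra_simps)
  then have "(x\<^sup>2 / (1 + x\<^sup>2))\<^sup>2 \<le> (y\<^sup>2 / (1 + y\<^sup>2))\<^sup>2"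
    by (intro power_mono) auto
  then show ?thesis by (simp add: G_def)
qed

lemma A_nonneg: "0 \<le> z \<Longrightarrow> 0 \<le> A z"
  by (simp add: A_def)

lemma DERIV_F_left: "((\<lambda>x. F x y z) has_real_derivative A z * y + B z - G x) (at x)"
proof -
  have "((\<lambda>x. F x y z) has_real_derivative A z * 1 * y + B z * (1 + 0) + 0 + - G x + 0) (at x)"
    unfolding F_def
    by (intro DERIV_add DERIV_cmult_right DERIV_cmult DERIV_g DERIV_const DERIV_ident)
  then show ?thesis by simp
qed

lemma F_decrease_to_z:
  assumes "0 \<le> z" "z \<le> y" "z \<le> x"
  shows "F z y z \<le> F x y z"
proof (rule DERIV_nonneg_imp_nondecreasing[OF assms(3)])
  fix t assume t: "z \<le> t" "t \<le> x"
  have "G t \<le> G z" using assms t by (intro G_antimono)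
  also have "\<dots> = A z * z + B z" by (simp add: G_diagonal)
  also have "\<dots> \<le> A z * y + B z" using assms A_nonneg by (simp add: mult_left_mono)
  finally show "\<exists>d. ((\<lambda>x. F x y z) has_real_derivative d) (at t) \<and> 0 \<le> d"
    by (intro exI[of _ "A z * y + B z - G t"] conjI DERIV_F_left) simp
qed

lemma F_increase_to_z:
  assumes "0 \<le> x" "x \<le> z" "y \<le> z"
  shows "F z y z \<le> F x y z"
proof (rule DERIV_nonpos_imp_nonincreasing[OF assms(2)])
  fix t assume t: "x \<le> t" "t \<le> z"
  have "A z * y + B z \<le> A z * z + B z" using assms A_nonneg by (simp add: mult_left_mono)
  also have "\<dots> = G z" by (simp add: G_diagonal)
  also have "\<dots> \<le> G t" using assms t by (intro G_antimono) auto
  finally show "\<exists>d. ((\<lambda>x. F x y z) has_real_derivative d) (at t) \<and> d \<le> 0"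
    by (intro exI[of _ "A z * y + B z - G t"] conjI DERIV_F_left) simp
qed

lemma F_nonneg_z_least:
  assumes "0 \<le> z" "z \<le> x" "z \<le> y"
  shows "0 \<le> F x y z"
  using F_decrease_to_z[of z y x] F_decrease_to_z[of z z y] F_commute[of z y z] F_diagonal[of z] assms
  by simp

lemma F_nonneg_z_greatest:
  assumes "0 \<le> x" "0 \<le> y" "x \<le> z" "y \<le> z"
  shows "0 \<le> F x y z"
  using F_increase_to_z[of x z y] F_increase_to_z[of y z z] F_commute[of z y z] F_diagonal[of z] assms
  by simp

section \<open>The curve of critical points in z\<close>

lemma X_denom_pos:
  assumes "0 < y" "y \<le> (z::real)"
  shows "0 < 2 * z - y + y * z\<^sup>2"
  using assms by (simp add: add_pos_pos)

lemma X_diagonal: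
  assumes "0 < y"
  shows "X y y = y"
  using X_denom_pos[OF assms order_refl] assms
  by (simp add: X_def divide_simps) algebra

lemma P_eq_0_iff:
  assumes "0 < y" "y \<le> z"
  shows "P x y z = 0 \<longleftrightarrow> x = X y z"
proof -
  have "P x y z = z * (z ^ 3 + 3 * z - 2 * y) - x * (2 * z - y + y * z\<^sup>2)"
    unfolding P_def by algebra
  then show ?thesis using X_denom_pos[OF assms] by (auto simp: X_def field_simps)
qed

lemma DERIV_X:
  assumes "0 < y" "y \<le> z"
  shows "\<exists>d\<ge>0. (X y has_real_derivative d) (at z)"
proof -
  let ?N = "z * (z ^ 3 + 3 * z - 2 * y)"
  let ?D = "2 * z - y + y * z\<^sup>2"
  have "(X y has_real_derivative
      ((4 * z ^ 3 + 6 * z - 2 * y) * ?D - ?N * (2 + 2 * y * z)) / (?D * ?D)) (at z)"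
    unfolding X_def[abs_def] using X_denom_pos[OF assms]
    by - (rule derivative_eq_intros refl | simp add: algebra_simps power2_eq_square power3_eq_cube)+
  moreover have "0 \<le> (4 * z ^ 3 + 6 * z - 2 * y) * ?D - ?N * (2 + 2 * y * z)"
  proof -
    \<comment> \<open>Collecting powers of z - y leaves only nonnegative terms.\<close>
    have "(4 * z ^ 3 + 6 * z - 2 * y) * ?D - ?N * (2 + 2 * y * z) =
        2 * z ^ 4 + 4 * z ^ 3 * (z - y) + 2 * y * z ^ 5 + 6 * z * (z - y) + 2 * y\<^sup>2 + 2 * y\<^sup>2 * z\<^sup>2"
      by algebra
    also have "\<dots> \<ge> 0" using assms by simp
    finally show ?thesis .
  qed
  ultimately show ?thesis by (meson divide_nonneg_nonneg zero_le_square)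
qed

text \<open>What the sign of the partial derivative in x along the curve amounts to once
  denominators and common factors are removed. After substituting z = y + d the difference of the
  two sides has only nonnegative coefficients in y and d.\<close>

lemma curve_polynomial_ineq:
  fixes y z :: real
  assumes "0 < y" "y \<le> z"
  shows "(1 + z\<^sup>2) * (z ^ 4 + (2 * z - y)\<^sup>2)\<^sup>2 \<le> z * (z ^ 3 + 3 * z - 2 * y) ^ 3"
proof -
  obtain d where d: "z = y + d" "0 \<le> d"
    using assms by (metis add_diff_cancel_left' diff_ge_0_iff_ge le_add_diff_inverse)
  have "z * (z ^ 3 + 3 * z - 2 * y) ^ 3 - (1 + z\<^sup>2) * (z ^ 4 + (2 * z - y)\<^sup>2)\<^sup>2 =
      11 * d ^ 4 + 3 * d ^ 6 + 22 * y * d ^ 3 + 22 * y * d ^ 5 + 2 * y * d ^ 7 +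
      12 * y ^ 2 * d ^ 2 + 51 * y ^ 2 * d ^ 4 + 12 * y ^ 2 * d ^ 6 + 2 * y ^ 3 * d +
      52 * y ^ 3 * d ^ 3 + 30 * y ^ 3 * d ^ 5 + 24 * y ^ 4 * d ^ 2 + 40 * y ^ 4 * d ^ 4 +
      4 * y ^ 5 * d + 30 * y ^ 5 * d ^ 3 + 12 * y ^ 6 * d ^ 2 + 2 * y ^ 7 * d"
    unfolding d(1) by algebra
  also have "\<dots> \<ge> 0" using assms d(2) by (intro add_nonneg_nonneg) simp_all
  finally show ?thesis by simp
qed

lemma F_left_nonneg_on_curve:
  assumes "0 < y" "y \<le> z"
  shows "G (X y z) \<le> A z * y + B z"
proof -
  define W where "W = 1 + z\<^sup>2"
  define m where "m = z ^ 3 + 3 * z - 2 * y"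
  define D where "D = 2 * z - y + y * z\<^sup>2"
  define R where "R = z ^ 4 + (2 * z - y)\<^sup>2"
  have "0 \<le> z ^ 3" using assms by simp
  then have m: "0 \<le> m" using assms unfolding m_def by linarith
  have pos: "0 < W" "0 \<le> m" "0 < D" "0 < R"
    using assms X_denom_pos m by (auto simp: W_def D_def R_def add_pos_nonneg)
  have "X y z = z * m / D" by (simp add: X_def m_def D_def)
  moreover have "D\<^sup>2 + (z * m)\<^sup>2 \<noteq> 0" "D \<noteq> 0" using pos by (auto simp: sum_power2_eq_zero_iff)
  ultimately have "(X y z)\<^sup>2 / (1 + (X y z)\<^sup>2) = (z * m)\<^sup>2 / (D\<^sup>2 + (z * m)\<^sup>2)"
    by (simp add: divide_simps) algebra
  \<comment> \<open>This factorisation brings the denominator of \<open>G (X y z)\<close> down to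
    powers of \<open>W\<close> and \<open>R\<close>.\<close>
  also have "D\<^sup>2 + (z * m)\<^sup>2 = W\<^sup>2 * R"
    unfolding W_def m_def D_def R_def by algebra
  finally have G: "G (X y z) = 4 - 4 * (z ^ 4 * m ^ 4 / (W ^ 4 * R\<^sup>2))"
    by (simp add: G_def power_divide power_mult_distrib flip: power_mult)
  have "A z * y + B z = 4 - 4 * (z ^ 3 * m / W ^ 3)"
    using pos(1) unfolding A_def B_def W_def[symmetric]
    by (simp add: divide_simps) (unfold W_def m_def, algebra)
  \<comment> \<open>Up to the nonnegative common factor \<open>z ^ 3 * m / W ^ 3\<close> this is
    \<open>curve_polynomial_ineq\<close>.\<close>
  moreover have "z ^ 3 * m / W ^ 3 \<le> z ^ 4 * m ^ 4 / (W ^ 4 * R\<^sup>2)"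
  proof -
    have "(z ^ 3 * m) * (W * R\<^sup>2) \<le> (z ^ 3 * m) * (z * m ^ 3)"
      using curve_polynomial_ineq[OF assms] assms pos(2)
      by (intro mult_left_mono) (simp_all add: W_def m_def R_def)
    then have "(z ^ 3 * m) * (W * R\<^sup>2) / (W ^ 3 * (W * R\<^sup>2)) \<le> z ^ 4 * m ^ 4 / (W ^ 3 * (W * R\<^sup>2))"
      using pos by (intro divide_right_mono) (simp_all add: algebra_simps power_numeral_reduce)
    then show ?thesis using pos by (simp add: power_numeral_reduce mult.assoc)
  qed
  ultimately show ?thesis using G by simp
qed

lemma F_nonneg_on_curve:
  assumes "0 < y" "y \<le> z"
  shows "0 \<le> F (X y z) y z"
proof -
  have "F (X y y) y y \<le> F (X y z) y z"
  proof (rule DERIV_nonneg_imp_nondecreasing[OF assms(2)])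
    fix t assume t: "y \<le> t" "t \<le> z"
    obtain d where d: "0 \<le> d" "(X y has_real_derivative d) (at t)"
      using DERIV_X[OF assms(1) t(1)] by auto
    \<comment> \<open>The explicit dependence on z thus adds nothing to the total
      derivative.\<close>
    have "P (X y t) y t = 0" using P_eq_0_iff[OF assms(1) t(1)] by simp
    then have "((\<lambda>t. F (X y t) y t) has_real_derivative (A t * y + B t - G (X y t)) * d) (at t)"
      using DERIV_F_curve[OF d(2), of y] by simp
    moreover have "0 \<le> (A t * y + B t - G (X y t)) * d"
      using F_left_nonneg_on_curve[OF assms(1) t(1)] d by simp
    ultimately show "\<exists>d. ((\<lambda>t. F (X y t) y t) has_real_derivative d) (at t) \<and> 0 \<le> d" by blast
  qed
  then show ?thesis using X_diagonal[OF assms(1)] F_diagonal by simp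
qed

section \<open>Minimisation over z\<close>

lemma DERIV_F_z:
  "((\<lambda>z. F x y z) has_real_derivative 24 * z\<^sup>2 * P x y z / (1 + z\<^sup>2) ^ 4) (at z)"
  using DERIV_F_curve[OF DERIV_const[of x], of y] by simp

lemma F_nonneg_between:
  assumes "0 < y" "y \<le> z" "z \<le> x"
  shows "0 \<le> F x y z"
proof -
  have "continuous_on {y..x} (\<lambda>z. F x y z)"
    by (meson DERIV_F_z DERIV_isCont continuous_at_imp_continuous_on)
  then obtain m where m: "m \<in> {y..x}" "\<And>t. t \<in> {y..x} \<Longrightarrow> F x y m \<le> F x y t"
    using continuous_attains_inf[of "{y..x}" "\<lambda>z. F x y z"] assms by auto
  have "0 \<le> F x y m"
  \<comment> \<open>A minimum at an endpoint falls under the cases where z is not strictly between y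
    and x.\<close>
  proof (cases "m = y \<or> m = x")
    case True
    then show ?thesis
      using assms F_nonneg_z_least[of y x y] F_nonneg_z_greatest[of x y x] by auto
  next
    case False
    then have "y < m" "m < x" using m(1) by auto
    have "24 * m\<^sup>2 * P x y m / (1 + m\<^sup>2) ^ 4 = 0"
    proof (rule DERIV_local_min[OF DERIV_F_z])
      show "0 < min (m - y) (x - m)" using \<open>y < m\<close> \<open>m < x\<close> by simp
      show "\<forall>t. \<bar>m - t\<bar> < min (m - y) (x - m) \<longrightarrow> F x y m \<le> F x y t"
        by (auto intro!: m(2))
    qed
    then have "P x y m = 0" using \<open>y < m\<close> assms by simp
    then have "x = X y m" using P_eq_0_iff assms \<open>y < m\<close> by simp
    then show ?thesis using F_nonneg_on_curve[of y m] assms \<open>y < m\<close> by simp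
  qed
  also have "\<dots> \<le> F x y z" using m(2) assms by simp
  finally show ?thesis .
qed

lemma F_nonneg_pos:
  assumes "0 < x" "0 < y" "0 \<le> z"
  shows "0 \<le> F x y z"
proof -
  consider "z \<le> x" "z \<le> y" | "x \<le> z" "y \<le> z" | "y \<le> z" "z \<le> x" | "x \<le> z" "z \<le> y" by linarith
  then show ?thesis
  proof cases
    case 1 then show ?thesis using assms F_nonneg_z_least by simp
  next
    case 2 then show ?thesis using assms F_nonneg_z_greatest by simp
  next
    case 3 then show ?thesis using assms F_nonneg_between by simp
  next
    case 4 then show ?thesis using assms F_nonneg_between[of x z y] F_commute by simp
  qed
qed

text \<open>The curve argument needs y > 0; continuity in x and y covers the boundary, both
  variables being shifted by a small e > 0.\<close>

lemma F_nonneg: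
  assumes "0 \<le> x" "0 \<le> y" "0 \<le> z"
  shows "0 \<le> F x y z"
proof -
  have "isCont g t" for t using DERIV_g DERIV_isCont by blast
  then have "((\<lambda>e. F (x + e) (y + e) z) \<longlongrightarrow> F (x + 0) (y + 0) z) (at_right 0)"
    unfolding F_def by (intro tendsto_intros isCont_tendsto_compose[of _ g])
  moreover have "\<forall>\<^sub>F e in at_right 0. 0 \<le> F (x + e) (y + e) z"
    using assms by (auto simp: eventually_at_filter intro!: always_eventually F_nonneg_pos)
  ultimately show ?thesis by (auto dest!: tendsto_lowerbound)
qed

section \<open>Return to the angle\<close>

lemma arctan_expr_eq_F:
  "arctan_expr (pi - 2 * arctan z) x y = F x y z"
proof -
  have s: "sin (pi - 2 * arctan z) = 2 * z / (1 + z\<^sup>2)"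
    by (simp add: sin_double sin_arctan cos_arctan)
  have "cos (pi - 2 * arctan z) = (z\<^sup>2 - 1) / (1 + z\<^sup>2)"
    by (simp add: cos_double sin_arctan cos_arctan power_divide diff_divide_distrib)
  then have c: "cos (pi - 2 * arctan z) ^ 3 - 3 * cos (pi - 2 * arctan z) + 2 = B z"
    unfolding B_def by (simp add: divide_simps) algebra
  have "(2 * z / (1 + z\<^sup>2)) ^ 3 = A z" by (simp add: A_def power_divide power_mult_distrib)
  then show ?thesis
    unfolding arctan_expr_def c s F_def K_def g_def by simp
qed

text \<open>The angle 0 corresponds to z = \<infinity>, so it is handled directly: the polynomial
  part in x and y vanishes, and each arctan is below pi/2.\<close>

lemma arctan_expr_0_nonneg:
  assumes "0 \<le> x" "0 \<le> y"
  shows "0 \<le> arctan_expr 0 x y"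
proof -
  have "0 \<le> 2 * x / (1 + x\<^sup>2)" "0 \<le> 2 * y / (1 + y\<^sup>2)" using assms by simp_all
  then show ?thesis
    using arctan_ubound[of x] arctan_ubound[of y] by (simp add: arctan_expr_def)
qed

lemma arctan_expr_half_angle:
  assumes "0 < \<theta>" "\<theta> \<le> pi"
  shows "arctan_expr \<theta> x y = F x y (cot (\<theta> / 2))" "0 \<le> cot (\<theta> / 2)"
proof -
  \<comment> \<open>The complementary angle lies in [0, pi/2), where arctan inverts tan.\<close>
  have cot: "cot (\<theta> / 2) = tan (pi / 2 - \<theta> / 2)"
    by (simp add: cot_def tan_def sin_diff cos_diff)
  then have "arctan (cot (\<theta> / 2)) = pi / 2 - \<theta> / 2"
    using assms by (simp add: arctan_tan)
  then have "\<theta> = pi - 2 * arctan (cot (\<theta> / 2))" by simp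
  then show "arctan_expr \<theta> x y = F x y (cot (\<theta> / 2))" by (metis arctan_expr_eq_F)
  show "0 \<le> cot (\<theta> / 2)"
    using assms by (simp add: cot_def sin_ge_zero cos_ge_zero)
qed

theorem lemma1:
  "(\<forall>x y \<theta> :: real. 0 \<le> x \<and> 0 \<le> y \<and> 0 \<le> \<theta> \<and> \<theta> \<le> pi
      \<longrightarrow> arctan_expr \<theta> x y \<ge> 0) \<and>
   (\<forall>\<theta> :: real. 0 < \<theta> \<and> \<theta> \<le> pi
      \<longrightarrow> arctan_expr \<theta> (cot (\<theta> / 2)) (cot (\<theta> / 2)) = 0)"
proof (intro conjI allI impI; elim conjE)
  fix x y \<theta> :: real
  assume "0 \<le> x" "0 \<le> y" "0 \<le> \<theta>" "\<theta> \<le> pi"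
  then show "0 \<le> arctan_expr \<theta> x y"
    using arctan_expr_0_nonneg arctan_expr_half_angle F_nonneg by (cases "\<theta> = 0") auto
next
  fix \<theta> :: real
  assume "0 < \<theta>" "\<theta> \<le> pi"
  then show "arctan_expr \<theta> (cot (\<theta> / 2)) (cot (\<theta> / 2)) = 0"
    by (simp add: arctan_expr_half_angle F_diagonal)
qed

end
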